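(* Let $Y=g(X,\varepsilon)$, where $\varepsilon$ has CDF $F_\varepsilon$, and let $V$ be a control variable. Suppose $E[Y\mid X,V]=p_0(X)'q(V)$ for a known $K$-vector of functions $q(V)$ and an unknown $K$-vector of functional coefficients $p_0(X)$, and that the average structural function (ASF) satisfies $\mu(X)\equiv\int g(X,\varepsilon)\,dF_\varepsilon(\varepsilon)=p_0(X)'E[q(V)]$. Then $E[q(V)]\in\mathcal{R}(E[q(V)q(V)'\mid X])$ with probability one if, and only if, the ASF is identified.
   Context: $K$ is finite; $\mathcal{R}(A)$ denotes the range (column space) of a matrix $A$. All expectations written are assumed to exist and be finite. ASF identification means: there is no measurable $\bar p$ that is observationally equivalent to $p_0$, i.e. $\bar p(X)'q(V)=p_0(X)'q(V)$ almost surely, and for which $\bar p(X)'E[q(V)]\neq p_0(X)'E[q(V)]$ with positive probability. *)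

theory Defs
  imports "HOL-Probability.Probability"
begin

definition rv_algebra :: "'w measure \<Rightarrow> 'x measure \<Rightarrow> ('w \<Rightarrow> 'x) \<Rightarrow> 'w measure" where
  "rv_algebra M N X = vimage_algebra (space M) X N"

(* Existence and finiteness of E[f | F] as a generalised conditional expectation: f itself need
   not be integrable, only E[|f| | F] must be finite almost surely. This is the weakest condition
   under which real_cond_exp, the difference of the conditional expectations of the positive and
   negative parts, is meaningful; it holds for every integrable f (has_cond_exp_integrable). *)
definition has_cond_exp :: "'w measure \<Rightarrow> 'w measure \<Rightarrow> ('w \<Rightarrow> real) \<Rightarrow> bool" where
  "has_cond_exp M F f \<longleftrightarrow>
     f \<in> borel_measurable M \<and> (AE w in M. nn_cond_exp M F (\<lambda>w. ennreal \<bar>f w\<bar>) w < \<infinity>)"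

definition cond_indep_given ::
  "'w measure \<Rightarrow> 'w measure \<Rightarrow> 'x measure \<Rightarrow> ('w \<Rightarrow> 'x) \<Rightarrow> 'e measure \<Rightarrow> ('w \<Rightarrow> 'e) \<Rightarrow> bool" where
  "cond_indep_given M F MX X ME eps \<longleftrightarrow>
     (\<forall>A \<in> sets MX. \<forall>B \<in> sets ME. AE w in M.
        real_cond_exp M F (\<lambda>w. indicator A (X w) * indicator B (eps w)) w =
        real_cond_exp M F (\<lambda>w. indicator A (X w)) w *
        real_cond_exp M F (\<lambda>w. indicator B (eps w)) w)"

definition control_variable ::
  "'w measure \<Rightarrow> 'x measure \<Rightarrow> ('w \<Rightarrow> 'x) \<Rightarrow> 'e measure \<Rightarrow> ('w \<Rightarrow> 'e) \<Rightarrow>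
   'v measure \<Rightarrow> ('w \<Rightarrow> 'v) \<Rightarrow> bool" where
  "control_variable M MX X ME eps MV V \<longleftrightarrow>
     V \<in> M \<rightarrow>\<^sub>M MV \<and> cond_indep_given M (rv_algebra M MV V) MX X ME eps"

(* Feps is the law of the disturbance, so that integration against its CDF is integration
   against this measure. *)
definition ASF :: "('x \<Rightarrow> 'e \<Rightarrow> real) \<Rightarrow> 'e measure \<Rightarrow> 'x \<Rightarrow> real" where
  "ASF g Feps x = (\<integral>e. g x e \<partial>Feps)"

(* The matrix E[Z Z' | F], entry by entry. *)
definition cond_second_moment ::
  "'w measure \<Rightarrow> 'w measure \<Rightarrow> ('w \<Rightarrow> real ^ 'k) \<Rightarrow> 'w \<Rightarrow> real ^ 'k ^ 'k" where
  "cond_second_moment M F Z w = (\<chi> i j. real_cond_exp M F (\<lambda>w. Z w $ i * Z w $ j) w)"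

definition column_space :: "real ^ 'n ^ 'm \<Rightarrow> (real ^ 'm) set" where
  "column_space A = range (\<lambda>x. A *v x)"

definition obs_equivalent ::
  "'w measure \<Rightarrow> ('w \<Rightarrow> 'x) \<Rightarrow> ('w \<Rightarrow> 'v) \<Rightarrow> ('v \<Rightarrow> real ^ 'k) \<Rightarrow>
   ('x \<Rightarrow> real ^ 'k) \<Rightarrow> ('x \<Rightarrow> real ^ 'k) \<Rightarrow> bool" where
  "obs_equivalent M X V q pbar p0 \<longleftrightarrow>
     (AE w in M. pbar (X w) \<bullet> q (V w) = p0 (X w) \<bullet> q (V w))"

definition ASF_identified ::
  "'w measure \<Rightarrow> 'x measure \<Rightarrow> ('w \<Rightarrow> 'x) \<Rightarrow> ('w \<Rightarrow> 'v) \<Rightarrow> ('v \<Rightarrow> real ^ 'k) \<Rightarrow>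
   ('x \<Rightarrow> real ^ 'k) \<Rightarrow> bool" where
  "ASF_identified M MX X V q p0 \<longleftrightarrow>
     \<not> (\<exists>pbar. pbar \<in> borel_measurable MX \<and> obs_equivalent M X V q pbar p0 \<and>
          0 < measure M {w \<in> space M. pbar (X w) \<bullet> (\<integral>w'. q (V w') \<partial>M) \<noteq>
                                      p0 (X w) \<bullet> (\<integral>w'. q (V w') \<partial>M)})"

lemma subalgebra_rv_algebra:
  assumes "X \<in> M \<rightarrow>\<^sub>M N"
  shows "subalgebra M (rv_algebra M N X)"
  using assms
  by (auto simp: subalgebra_def rv_algebra_def sets_vimage_algebra2 measurable_def)

lemma (in prob_space) has_cond_exp_integrable:
  assumes X: "X \<in> M \<rightarrow>\<^sub>M N" and f: "integrable M f"
  shows "has_cond_exp M (rv_algebra M N X) f"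
proof -
  let ?F = "rv_algebra M N X"
  interpret F: finite_measure_subalgebra M ?F
    by unfold_locales (rule subalgebra_rv_algebra[OF X])
  have [measurable]: "f \<in> borel_measurable M"
    using f by auto
  have "(\<integral>\<^sup>+ w. nn_cond_exp M ?F (\<lambda>w. ennreal \<bar>f w\<bar>) w \<partial>M) = (\<integral>\<^sup>+ w. ennreal \<bar>f w\<bar> \<partial>M)"
    using F.nn_cond_exp_intg[of "\<lambda>_. 1" "\<lambda>w. ennreal \<bar>f w\<bar>"] by simp
  also have "\<dots> \<noteq> \<infinity>"
    using f by (auto simp: integrable_iff_bounded)
  finally have "AE w in M. nn_cond_exp M ?F (\<lambda>w. ennreal \<bar>f w\<bar>) w \<noteq> \<infinity>"
    by (intro nn_integral_noteq_infinite) auto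
  then show ?thesis
    by (auto simp: has_cond_exp_def less_top)
qed

end

theory Submission
  imports Defs
begin

text \<open>Write \<open>Z = q(V)\<close> and \<open>A = E[Z Z' | X]\<close>. For a function \<open>d\<close> of \<open>X\<close>, the conditional second
  moment of \<open>d'Z\<close> is \<open>d'A d\<close>, so \<open>d'Z = 0\<close> almost surely exactly when \<open>A d = 0\<close> almost surely.
  Hence the coefficients observationally equivalent to \<open>p0\<close> are the \<open>p0 + d\<close> with \<open>d\<close> in the
  kernel of \<open>A\<close>, and as \<open>A\<close> is symmetric, \<open>d'E[Z]\<close> vanishes for all of them if \<open>E[Z]\<close> lies in the
  range of \<open>A\<close>. Conversely, the component \<open>d\<close> of \<open>E[Z]\<close> orthogonal to the range of \<open>A\<close> is a
  measurable function of \<open>X\<close> in the kernel of \<open>A\<close> with \<open>d'E[Z] = |d|^2\<close>.\<close>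

section \<open>Measurable orthogonal projection\<close>

text \<open>Gram--Schmidt without normalisation. A column depending linearly on the earlier ones gives
  \<open>u = 0\<close>, and then the division by zero yields the intended value \<open>0\<close>.\<close>

fun orth_residual :: "'a::real_inner list \<Rightarrow> 'a \<Rightarrow> 'a" where
  "orth_residual [] b = b"
| "orth_residual (a # as) b =
     (let u = orth_residual as a; r = orth_residual as b in r - ((r \<bullet> u) / (u \<bullet> u)) *\<^sub>R u)"

lemma orth_residual_in_span: "b - orth_residual as b \<in> span (set as)"
proof (induction as arbitrary: b)
  case Nil
  show ?case by simp
next
  case (Cons a as)
  let ?u = "orth_residual as a" and ?r = "orth_residual as b"
  let ?S = "span (set (a # as))"
  have mono: "span (set as) \<subseteq> ?S"
    by (rule span_mono) auto
  have "a - ?u \<in> ?S" "b - ?r \<in> ?S"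
    using Cons.IH mono by blast+
  moreover have "a \<in> ?S"
    by (simp add: span_base)
  \<comment> \<open>The term \<open>a - (a - ?u)\<close> is \<open>?u\<close>, written as a
    difference of two members of the span.\<close>
  ultimately have "(b - ?r) + ((?r \<bullet> ?u) / (?u \<bullet> ?u)) *\<^sub>R (a - (a - ?u)) \<in> ?S"
    by (metis span_add span_diff span_scale)
  then show ?case
    by (simp add: Let_def algebra_simps)
qed

text \<open>Subtracting the multiple of \<open>u\<close> makes the result orthogonal to
  \<open>u\<close>. By induction \<open>r\<close> and \<open>u\<close> are both orthogonal to the
  earlier vectors, and \<open>a\<close> is \<open>u\<close> plus a combination of those.\<close>

lemma orth_residual_orthogonal: "x \<in> span (set as) \<Longrightarrow> orth_residual as b \<bullet> x = 0"
proof (induction as arbitrary: b x)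
  case Nil
  then show ?case by simp
next
  case (Cons a as)
  let ?u = "orth_residual as a" and ?r = "orth_residual as b"
  let ?R = "orth_residual (a # as) b"
  have orth_as: "?R \<bullet> y = 0" if "y \<in> span (set as)" for y
    using Cons.IH[OF that] by (simp add: Let_def inner_diff_left)
  have orth_u: "?R \<bullet> ?u = 0"
    by (cases "?u = 0") (simp_all add: Let_def inner_diff_left)
  have "?R \<bullet> a = ?R \<bullet> (a - ?u) + ?R \<bullet> ?u"
    by (simp add: inner_diff_right)
  then have orth_a: "?R \<bullet> a = 0"
    using orth_as[OF orth_residual_in_span] orth_u by simp
  obtain c where "x - c *\<^sub>R a \<in> span (set as)"
    using Cons.prems by (auto simp: span_insert)
  from orth_as[OF this] orth_a show ?case
    by (simp add: inner_diff_right)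
qed

text \<open>The part of \<open>b\<close> that was removed lies in the span, to which the residual is
  orthogonal. Hence a residual orthogonal to \<open>b\<close> must vanish.\<close>

lemma inner_orth_residual: "orth_residual as b \<bullet> b = orth_residual as b \<bullet> orth_residual as b"
  using orth_residual_orthogonal[OF orth_residual_in_span, of as b b]
  by (simp add: inner_diff_right)

text \<open>The recursion consists of inner products, division, scaling and subtraction, so
  measurability passes through it. This is the reason for projecting by an explicit formula.\<close>

lemma borel_measurable_orth_residual:
  fixes b :: "'w \<Rightarrow> 'a::euclidean_space"
  assumes "\<And>f. f \<in> set fs \<Longrightarrow> f \<in> borel_measurable F" and "b \<in> borel_measurable F"
  shows "(\<lambda>w. orth_residual (map (\<lambda>f. f w) fs) (b w)) \<in> borel_measurable F"
  using assms
proof (induction fs arbitrary: b)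
  case Nil
  then show ?case by simp
next
  case (Cons f fs)
  have [measurable]: "(\<lambda>w. orth_residual (map (\<lambda>f. f w) fs) (f w)) \<in> borel_measurable F"
    "(\<lambda>w. orth_residual (map (\<lambda>f. f w) fs) (b w)) \<in> borel_measurable F"
    using Cons by auto
  show ?case
    by (simp add: Let_def)
qed

lemma column_space_eq_span: "column_space A = span (columns A)"
proof
  show "column_space A \<subseteq> span (columns A)"
    unfolding column_space_def by (auto simp: matrix_vector_mult_in_columnspace)
  have "column j A \<in> column_space A" for j
    unfolding column_space_def by (metis matrix_vector_mult_basis rangeI)
  moreover have "subspace (column_space A)"
    unfolding column_space_def by (intro linear_subspace_image) auto
  ultimately show "span (columns A) \<subseteq> column_space A"
    by (intro span_minimal) (auto simp: columns_def)
qed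

section \<open>Functions measurable with respect to a random variable\<close>

text \<open>The Doob-Dynkin lemma. Each level set of an approximating simple function is a preimage
  under \<open>X\<close>, so the simple functions factor through \<open>X\<close>, and their
  pointwise limit does too.\<close>

lemma rv_algebra_factorization:
  fixes f :: "'w \<Rightarrow> 'b::{banach, second_countable_topology}"
  assumes X: "X \<in> M \<rightarrow>\<^sub>M N" and f: "f \<in> borel_measurable (rv_algebra M N X)"
  obtains h where "h \<in> borel_measurable N" "\<And>w. w \<in> space M \<Longrightarrow> f w = h (X w)"
proof -
  let ?F = "rv_algebra M N X"
  have space: "space ?F = space M"
    by (simp add: rv_algebra_def)
  obtain s where s: "\<And>i. simple_function ?F (s i)"
    and lim: "\<And>w. w \<in> space M \<Longrightarrow> (\<lambda>i. s i w) \<longlonglongrightarrow> f w"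
    using borel_measurable_implies_sequence_metric[OF f] unfolding space by metis
  have "\<exists>B \<in> sets N. s i -` {y} \<inter> space M = X -` B \<inter> space M" for i y
  proof -
    have "s i -` {y} \<inter> space M \<in> sets ?F"
      using simple_functionD(2)[OF s, of i "{y}"] by (simp add: space)
    then show ?thesis
      using X by (auto simp: rv_algebra_def sets_vimage_algebra2 measurable_def)
  qed
  then obtain B where B[measurable]: "\<And>i y. B i y \<in> sets N"
    and s_B: "\<And>i y. s i -` {y} \<inter> space M = X -` B i y \<inter> space M"
    by metis
  define h where "h i x = (\<Sum>y\<in>s i ` space M. indicator (B i y) x *\<^sub>R y)" for i x
  have h_meas [measurable]: "h i \<in> borel_measurable N" for i
    unfolding h_def by measurable
  have h_s: "h i (X w) = s i w" if w: "w \<in> space M" for i w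
  proof -
    have fin: "finite (s i ` space M)"
      using simple_functionD(1)[OF s, of i] by (simp add: space)
    \<comment> \<open>The sets \<open>B i y\<close> for different \<open>y\<close> may overlap off
      the range of \<open>X\<close>, but on that range \<open>X w\<close> lies in exactly one of
      them, the one for \<open>y = s i w\<close>.\<close>
    have "h i (X w) = (\<Sum>y\<in>s i ` space M. if y = s i w then y else 0)"
      unfolding h_def
    proof (rule sum.cong)
      fix y
      have "X w \<in> B i y \<longleftrightarrow> y = s i w"
        using s_B[of i y] w by auto
      then show "indicator (B i y) (X w) *\<^sub>R y = (if y = s i w then y else 0)"
        by (simp add: indicator_def)
    qed simp
    also have "\<dots> = s i w"
      using fin w by (simp add: sum.delta)
    finally show ?thesis .
  qed
  show thesis
  proof
    \<comment> \<open>Off the range of \<open>X\<close> the sequence may diverge; \<open>lim\<close>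
      still gives a measurable function, and its values there do not matter.\<close>
    show "(\<lambda>x. lim (\<lambda>i. h i x)) \<in> borel_measurable N"
      by measurable
    show "f w = lim (\<lambda>i. h i (X w))" if "w \<in> space M" for w
      using limI[OF lim[OF that]] by (simp add: h_s that)
  qed
qed

lemma borel_measurable_vec_nth [measurable (raw)]:
  fixes f :: "'w \<Rightarrow> real ^ 'k"
  assumes "f \<in> borel_measurable M"
  shows "(\<lambda>w. f w $ i) \<in> borel_measurable M"
  using assms by (simp add: cart_eq_inner_axis)

lemma borel_measurable_vecI:
  fixes f :: "'w \<Rightarrow> real ^ 'k"
  assumes "\<And>i. (\<lambda>w. f w $ i) \<in> borel_measurable M"
  shows "f \<in> borel_measurable M"
  by (subst borel_measurable_euclidean_space) (use assms in \<open>auto simp: Basis_vec_def inner_axis\<close>)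

section \<open>The kernel of the conditional second moment matrix\<close>

lemma cond_second_moment_sym:
  "cond_second_moment M F Z w $ i $ j = cond_second_moment M F Z w $ j $ i"
  by (simp add: cond_second_moment_def mult.commute)

lemma borel_measurable_column_cond_second_moment:
  "(\<lambda>w. column j (cond_second_moment M F Z w)) \<in> borel_measurable F"
  by (rule borel_measurable_vecI) (simp add: column_def cond_second_moment_def)

text \<open>The matrix is symmetric and so moves across the inner product. Testing against its value
  at \<open>d\<close> gives the forward direction.\<close>

lemma cond_second_moment_orth_column_space:
  "(\<forall>y \<in> column_space (cond_second_moment M F Z w). d \<bullet> y = 0) \<longleftrightarrow>
     cond_second_moment M F Z w *v d = 0"
proof -
  let ?A = "cond_second_moment M F Z w"
  have "transpose ?A = ?A"
    by (simp add: vec_eq_iff transpose_def cond_second_moment_sym)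
  then have "d \<bullet> (?A *v x) = (?A *v d) \<bullet> x" for x
    by (metis dot_lmul_matrix transpose_matrix_vector)
  then show ?thesis
    by (auto simp: column_space_def inner_eq_zero_iff dest: spec[where x = "cond_second_moment M F Z w *v d"])
qed

context finite_measure_subalgebra
begin

text \<open>Here \<open>f\<close> itself need not be integrable. As \<open>c\<close> is measurable
  in \<open>F\<close>, the integral of \<open>\<bar>c f\<bar>\<close> equals that of
  \<open>\<bar>c\<bar>\<close> times the conditional expectation of \<open>\<bar>f\<bar>\<close>,
  which is bounded on a finite measure space.\<close>

lemma integrable_mult_cond_bounded:
  assumes c [measurable]: "c \<in> borel_measurable F" and f: "has_cond_exp M F f"
    and bound: "\<And>w. \<bar>c w\<bar> * enn2real (nn_cond_exp M F (\<lambda>w. ennreal \<bar>f w\<bar>) w) \<le> C"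
  shows "integrable M (\<lambda>w. c w * f w)"
proof (rule integrableI_bounded)
  have [measurable]: "f \<in> borel_measurable M"
    and fin: "AE w in M. nn_cond_exp M F (\<lambda>w. ennreal \<bar>f w\<bar>) w < \<infinity>"
    using f by (auto simp: has_cond_exp_def)
  have [measurable]: "c \<in> borel_measurable M"
    by (rule measurable_from_subalg[OF subalg c])
  show "(\<lambda>w. c w * f w) \<in> borel_measurable M"
    by measurable
  have "(\<integral>\<^sup>+ w. ennreal (norm (c w * f w)) \<partial>M) = (\<integral>\<^sup>+ w. ennreal \<bar>c w\<bar> * ennreal \<bar>f w\<bar> \<partial>M)"
    by (simp add: abs_mult ennreal_mult)
  also have "\<dots> = (\<integral>\<^sup>+ w. ennreal \<bar>c w\<bar> * nn_cond_exp M F (\<lambda>w. ennreal \<bar>f w\<bar>) w \<partial>M)"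
    by (rule nn_cond_exp_intg[symmetric]) measurable
  also have "\<dots> \<le> (\<integral>\<^sup>+ w. ennreal C \<partial>M)"
  proof (rule nn_integral_mono_AE)
    \<comment> \<open>\<open>enn2real\<close> sends infinity to 0, so \<open>bound\<close> controls
      the product only where the conditional expectation is finite.\<close>
    show "AE w in M. ennreal \<bar>c w\<bar> * nn_cond_exp M F (\<lambda>w. ennreal \<bar>f w\<bar>) w \<le> ennreal C"
      using fin
    proof eventually_elim
      case (elim w)
      then have "ennreal \<bar>c w\<bar> * nn_cond_exp M F (\<lambda>w. ennreal \<bar>f w\<bar>) w =
        ennreal (\<bar>c w\<bar> * enn2real (nn_cond_exp M F (\<lambda>w. ennreal \<bar>f w\<bar>) w))"
        by (simp add: ennreal_mult less_top)
      then show ?case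
        using bound[of w] by (simp add: ennreal_leI)
    qed
  qed
  also have "\<dots> < \<infinity>"
    by (simp add: ennreal_mult_less_top emeasure_eq_measure)
  finally show "(\<integral>\<^sup>+ w. ennreal (norm (c w * f w)) \<partial>M) < \<infinity>" .
qed

text \<open>Since \<open>d\<close> is measurable in \<open>F\<close>, the matrix applied to
  \<open>d\<close> is the conditional expectation of \<open>Z\<close> times
  \<open>d \<bullet> Z\<close>; \<open>int1\<close> justifies this for the forward direction.
  Conversely, \<open>int2\<close> makes the integral of the square of \<open>d \<bullet> Z\<close>
  equal to that of the quadratic form in \<open>d\<close>, which vanishes.\<close>

lemma cond_second_moment_kernel_iff_integrable:
  fixes Z d :: "'a \<Rightarrow> real ^ 'k"
  assumes Z [measurable]: "Z \<in> borel_measurable M"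
    and d [measurable]: "d \<in> borel_measurable F"
    and int1: "\<And>i j. integrable M (\<lambda>w. d w $ j * (Z w $ i * Z w $ j))"
    and int2: "\<And>i j. integrable M (\<lambda>w. (d w $ i * d w $ j) * (Z w $ i * Z w $ j))"
  shows "(AE w in M. d w \<bullet> Z w = 0) \<longleftrightarrow> (AE w in M. cond_second_moment M F Z w *v d w = 0)"
proof
  have dM [measurable]: "d \<in> borel_measurable M"
    by (rule measurable_from_subalg[OF subalg d])
  have Av: "(cond_second_moment M F Z w *v d w) $ i =
      (\<Sum>j\<in>UNIV. d w $ j * real_cond_exp M F (\<lambda>w. Z w $ i * Z w $ j) w)" for w i
    by (simp add: cond_second_moment_def matrix_vector_mult_def mult.commute)
  {
    assume 0: "AE w in M. d w \<bullet> Z w = 0"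
    have "AE w in M. (cond_second_moment M F Z w *v d w) $ i = 0" for i
    proof -
      have 1: "AE w in M. \<forall>j. real_cond_exp M F (\<lambda>w. d w $ j * (Z w $ i * Z w $ j)) w =
          d w $ j * real_cond_exp M F (\<lambda>w. Z w $ i * Z w $ j) w"
        unfolding AE_all_countable by (intro allI real_cond_exp_mult int1) measurable
      have 2: "AE w in M. real_cond_exp M F (\<lambda>w. \<Sum>j\<in>UNIV. d w $ j * (Z w $ i * Z w $ j)) w =
          (\<Sum>j\<in>UNIV. real_cond_exp M F (\<lambda>w. d w $ j * (Z w $ i * Z w $ j)) w)"
        by (intro real_cond_exp_sum int1)
      have "(\<Sum>j\<in>UNIV. d w $ j * (Z w $ i * Z w $ j)) = Z w $ i * (d w \<bullet> Z w)" for w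
        by (simp add: inner_vec_def sum_distrib_left mult_ac)
      then have "AE w in M. (\<Sum>j\<in>UNIV. d w $ j * (Z w $ i * Z w $ j)) = 0"
        using 0 by auto
      then have 3: "AE w in M. real_cond_exp M F (\<lambda>w. \<Sum>j\<in>UNIV. d w $ j * (Z w $ i * Z w $ j)) w =
          real_cond_exp M F (\<lambda>w. 0) w"
        by (rule real_cond_exp_cong) measurable
      have 4: "AE w in M. real_cond_exp M F (\<lambda>w. 0) w = 0"
        by (rule real_cond_exp_F_meas) auto
      show ?thesis
        using 1 2 3 4 by eventually_elim (simp add: Av)
    qed
    then show "AE w in M. cond_second_moment M F Z w *v d w = 0"
      by (simp add: vec_eq_iff AE_all_countable)
  next
    assume 0: "AE w in M. cond_second_moment M F Z w *v d w = 0"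
    let ?E = "\<lambda>i j w. real_cond_exp M F (\<lambda>w. Z w $ i * Z w $ j) w"
    have intE: "integrable M (\<lambda>w. (d w $ i * d w $ j) * ?E i j w)"
      "(\<integral>w. (d w $ i * d w $ j) * ?E i j w \<partial>M) = (\<integral>w. (d w $ i * d w $ j) * (Z w $ i * Z w $ j) \<partial>M)"
      for i j
      using int2 by (intro real_cond_exp_intg; measurable)+
    have square: "(d w \<bullet> Z w)\<^sup>2 =
        (\<Sum>i\<in>UNIV. \<Sum>j\<in>UNIV. (d w $ i * d w $ j) * (Z w $ i * Z w $ j))" for w
      by (simp add: inner_vec_def power2_eq_square sum_product mult_ac)
    have quad: "(\<Sum>i\<in>UNIV. \<Sum>j\<in>UNIV. (d w $ i * d w $ j) * ?E i j w) =
        d w \<bullet> (cond_second_moment M F Z w *v d w)" for w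
      by (simp add: inner_vec_def Av sum_distrib_left mult_ac)
    have "(\<integral>w. (d w \<bullet> Z w)\<^sup>2 \<partial>M) =
        (\<integral>w. (\<Sum>i\<in>UNIV. \<Sum>j\<in>UNIV. (d w $ i * d w $ j) * ?E i j w) \<partial>M)"
      unfolding square by (simp add: Bochner_Integration.integral_sum int2 intE)
    also have "\<dots> = (\<integral>w. 0 \<partial>M)"
    proof (rule integral_cong_AE)
      show "AE w in M. (\<Sum>i\<in>UNIV. \<Sum>j\<in>UNIV. (d w $ i * d w $ j) * ?E i j w) = 0"
        using 0 by eventually_elim (simp add: quad)
    qed measurable
    finally have "(\<integral>w. (d w \<bullet> Z w)\<^sup>2 \<partial>M) = 0"
      by simp
    moreover have "integrable M (\<lambda>w. (d w \<bullet> Z w)\<^sup>2)"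
      unfolding square by (intro Bochner_Integration.integrable_sum int2)
    ultimately have "AE w in M. (d w \<bullet> Z w)\<^sup>2 = 0"
      by (subst (asm) integral_nonneg_eq_0_iff_AE) auto
    then show "AE w in M. d w \<bullet> Z w = 0"
      by simp
  }
qed

lemma cond_second_moment_kernel_iff:
  fixes Z d :: "'a \<Rightarrow> real ^ 'k"
  assumes Z [measurable]: "Z \<in> borel_measurable M"
    and d [measurable]: "d \<in> borel_measurable F"
    and ZZ: "\<And>i j. has_cond_exp M F (\<lambda>w. Z w $ i * Z w $ j)"
  shows "(AE w in M. d w \<bullet> Z w = 0) \<longleftrightarrow> (AE w in M. cond_second_moment M F Z w *v d w = 0)"
proof -
  define N where "N i j w = enn2real (nn_cond_exp M F (\<lambda>w. ennreal \<bar>Z w $ i * Z w $ j\<bar>) w)" for i j w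
  define S where "S w = (\<Sum>i\<in>UNIV. \<Sum>j\<in>UNIV. N i j w)" for w
  \<comment> \<open>Both sides are unchanged when \<open>d\<close> is rescaled by a positive function; this one makes the
    products with \<open>Z Z'\<close> integrable.\<close>
  define r where "r w = inverse ((1 + norm (d w)) * (1 + S w))" for w
  define e where "e w = r w *\<^sub>R d w" for w
  have N_nonneg: "0 \<le> N i j w" for i j w
    by (simp add: N_def)
  have N_le_S: "N i j w \<le> S w" for i j w
  proof -
    have "N i j w \<le> (\<Sum>j\<in>UNIV. N i j w)"
      by (intro member_le_sum N_nonneg) auto
    also have "\<dots> \<le> S w"
      unfolding S_def
      by (rule member_le_sum[where f = "\<lambda>i. \<Sum>j\<in>UNIV. N i j w"]) (auto intro: sum_nonneg N_nonneg)
    finally show ?thesis .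
  qed
  have S_nonneg: "0 \<le> S w" for w
    unfolding S_def by (intro sum_nonneg N_nonneg)
  have [measurable]: "N i j \<in> borel_measurable F" for i j
    unfolding N_def by measurable
  have [measurable]: "S \<in> borel_measurable F"
    unfolding S_def by measurable
  have [measurable]: "e \<in> borel_measurable F"
    unfolding e_def r_def by measurable
  have r_pos: "0 < r w" for w
    unfolding r_def using S_nonneg[of w] by (auto intro!: mult_pos_pos add_pos_nonneg)
  \<comment> \<open>The factor \<open>1 + norm (d w)\<close> in \<open>r\<close> bounds
    \<open>d\<close>, and \<open>1 + S w\<close> absorbs every conditional absolute moment, each
    being at most \<open>S w\<close>. The added ones keep the inverse well defined and
    positive.\<close>
  have e_le: "norm (e w) * (1 + S w) \<le> 1" for w
  proof -
    have "1 + S w \<noteq> 0"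
      using S_nonneg[of w] by linarith
    moreover have "norm (e w) = norm (d w) / ((1 + norm (d w)) * (1 + S w))"
      using r_pos[of w] by (simp add: e_def r_def field_class.field_divide_inverse)
    ultimately have "norm (e w) * (1 + S w) = norm (d w) / (1 + norm (d w))"
      by simp
    also have "\<dots> \<le> 1"
      by (simp add: divide_le_eq_1 add_pos_nonneg)
    finally show ?thesis .
  qed
  have norm_e_le: "norm (e w) \<le> 1" for w
    using e_le[of w] S_nonneg[of w] mult_left_mono[of 1 "1 + S w" "norm (e w)"] by simp
  have bound1: "\<bar>e w $ j\<bar> * N i j w \<le> 1" for i j w
  proof -
    have "\<bar>e w $ j\<bar> * N i j w \<le> norm (e w) * (1 + S w)"
      using N_le_S[of i j w] N_nonneg[of i j w] by (intro mult_mono component_le_norm_cart) auto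
    with e_le[of w] show ?thesis by linarith
  qed
  have bound2: "\<bar>e w $ i * e w $ j\<bar> * N i j w \<le> 1" for i j w
  proof -
    have "\<bar>e w $ i * e w $ j\<bar> * N i j w = \<bar>e w $ i\<bar> * (\<bar>e w $ j\<bar> * N i j w)"
      by (simp add: abs_mult)
    also have "\<dots> \<le> 1 * 1"
      using component_le_norm_cart[of "e w" i] norm_e_le[of w] N_nonneg[of i j w]
      by (intro mult_mono bound1) auto
    finally show ?thesis by simp
  qed
  have "(AE w in M. e w \<bullet> Z w = 0) \<longleftrightarrow> (AE w in M. cond_second_moment M F Z w *v e w = 0)"
  proof (rule cond_second_moment_kernel_iff_integrable)
    show "integrable M (\<lambda>w. e w $ j * (Z w $ i * Z w $ j))" for i j
      using ZZ bound1 unfolding N_def by (intro integrable_mult_cond_bounded[where C = 1]) measurable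
    show "integrable M (\<lambda>w. (e w $ i * e w $ j) * (Z w $ i * Z w $ j))" for i j
      using ZZ bound2 unfolding N_def by (intro integrable_mult_cond_bounded[where C = 1]) measurable
  qed measurable
  moreover have "r w \<noteq> 0" for w
    using r_pos[of w] by simp
  ultimately show ?thesis
    by (simp add: e_def matrix_vector_mult_scaleR)
qed

end

section \<open>Identification of the average structural function\<close>

lemma (in prob_space) measure_pos_iff_not_AE:
  assumes "{w \<in> space M. P w} \<in> sets M"
  shows "0 < measure M {w \<in> space M. P w} \<longleftrightarrow> \<not> (AE w in M. \<not> P w)"
proof -
  have "(AE w in M. \<not> P w) \<longleftrightarrow> emeasure M {w \<in> space M. P w} = 0"
    using assms by (subst AE_iff_measurable) auto
  then show ?thesis
    by (simp add: emeasure_eq_measure zero_less_measure_iff)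
qed

theorem theorem5:
  fixes M :: "'w measure" and MX :: "'x measure" and MV :: "'v measure" and ME :: "'e measure"
    and X :: "'w \<Rightarrow> 'x" and V :: "'w \<Rightarrow> 'v" and eps :: "'w \<Rightarrow> 'e" and Y :: "'w \<Rightarrow> real"
    and g :: "'x \<Rightarrow> 'e \<Rightarrow> real"
    and q :: "'v \<Rightarrow> real ^ 'k" and p0 :: "'x \<Rightarrow> real ^ 'k"
  assumes "prob_space M"
    and "X \<in> M \<rightarrow>\<^sub>M MX" and "eps \<in> M \<rightarrow>\<^sub>M ME" and "Y \<in> borel_measurable M"
    and "q \<in> borel_measurable MV" and "p0 \<in> borel_measurable MX"
    and control: "control_variable M MX X ME eps MV V"
    and outcome: "AE w in M. Y w = g (X w) (eps w)"
    and Y_cond: "has_cond_exp M (rv_algebra M (MX \<Otimes>\<^sub>M MV) (\<lambda>w. (X w, V w))) Y"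
    and regression: "AE w in M.
      real_cond_exp M (rv_algebra M (MX \<Otimes>\<^sub>M MV) (\<lambda>w. (X w, V w))) Y w = p0 (X w) \<bullet> q (V w)"
    and g_int: "AE w in M. integrable (distr M ME eps) (g (X w))"
    and q_int: "integrable M (\<lambda>w. q (V w))"
    and q_cond: "\<And>i j. has_cond_exp M (rv_algebra M MX X) (\<lambda>w. q (V w) $ i * q (V w) $ j)"
    and ASF_eq: "AE w in M. ASF g (distr M ME eps) (X w) = p0 (X w) \<bullet> (\<integral>w'. q (V w') \<partial>M)"
  shows "(AE w in M. (\<integral>w'. q (V w') \<partial>M) \<in>
            column_space (cond_second_moment M (rv_algebra M MX X) (\<lambda>w. q (V w)) w))
         \<longleftrightarrow> ASF_identified M MX X V q p0"
proof -
  interpret prob_space M by fact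
  note X [measurable] = \<open>X \<in> M \<rightarrow>\<^sub>M MX\<close>
  note p0 [measurable] = \<open>p0 \<in> borel_measurable MX\<close>
  note [measurable] = \<open>q \<in> borel_measurable MV\<close>
  have [measurable]: "V \<in> M \<rightarrow>\<^sub>M MV"
    using control by (simp add: control_variable_def)
  define F where "F = rv_algebra M MX X"
  interpret F: finite_measure_subalgebra M F
    unfolding F_def by unfold_locales (rule subalgebra_rv_algebra[OF X])
  have X_F [measurable]: "X \<in> F \<rightarrow>\<^sub>M MX"
    using X unfolding F_def rv_algebra_def
    by (intro measurable_vimage_algebra1) (auto simp: measurable_def)
  define Z where "Z w = q (V w)" for w
  have Z [measurable]: "Z \<in> borel_measurable M"
    unfolding Z_def by measurable
  define b where "b = (\<integral>w. Z w \<partial>M)"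
  define A where "A w = cond_second_moment M F Z w" for w
  have kernel: "(AE w in M. d w \<bullet> Z w = 0) \<longleftrightarrow> (AE w in M. A w *v d w = 0)"
    if "d \<in> borel_measurable F" for d
    unfolding A_def using that q_cond
    by (intro F.cond_second_moment_kernel_iff Z) (auto simp: F_def Z_def)
  have orth: "(\<forall>y \<in> column_space (A w). c \<bullet> y = 0) \<longleftrightarrow> A w *v c = 0" for w c
    unfolding A_def by (rule cond_second_moment_orth_column_space)
  \<comment> \<open>Observational equivalence and equality of the ASF depend only on the difference
    \<open>h\<close> of \<open>p\<close> and \<open>p0\<close>, so \<open>p0\<close> drops out of
    the condition.\<close>
  have identified_iff: "ASF_identified M MX X V q p0 \<longleftrightarrow>
    (\<forall>h \<in> borel_measurable MX.
       (AE w in M. h (X w) \<bullet> Z w = 0) \<longrightarrow> (AE w in M. h (X w) \<bullet> b = 0))"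
  proof -
    have pos: "0 < measure M {w \<in> space M. p (X w) \<bullet> b \<noteq> p0 (X w) \<bullet> b} \<longleftrightarrow>
        \<not> (AE w in M. (p (X w) - p0 (X w)) \<bullet> b = 0)"
      if [measurable]: "p \<in> borel_measurable MX" for p
      by (subst measure_pos_iff_not_AE) (simp_all add: inner_diff_left)
    have obs: "obs_equivalent M X V q p p0 \<longleftrightarrow>
        (AE w in M. (p (X w) - p0 (X w)) \<bullet> Z w = 0)" for p
      by (simp add: obs_equivalent_def Z_def inner_diff_left)
    have "ASF_identified M MX X V q p0 \<longleftrightarrow>
      (\<forall>p \<in> borel_measurable MX. obs_equivalent M X V q p p0 \<longrightarrow>
         \<not> 0 < measure M {w \<in> space M. p (X w) \<bullet> b \<noteq> p0 (X w) \<bullet> b})"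
      unfolding ASF_identified_def b_def Z_def by blast
    also have "\<dots> \<longleftrightarrow>
      (\<forall>p \<in> borel_measurable MX. (AE w in M. (p (X w) - p0 (X w)) \<bullet> Z w = 0) \<longrightarrow>
         (AE w in M. (p (X w) - p0 (X w)) \<bullet> b = 0))"
      by (intro ball_cong refl) (simp only: pos obs not_not)
    also have "\<dots> \<longleftrightarrow> (\<forall>h \<in> borel_measurable MX.
       (AE w in M. h (X w) \<bullet> Z w = 0) \<longrightarrow> (AE w in M. h (X w) \<bullet> b = 0))"
    proof (intro iffI ballI)
      fix h :: "'x \<Rightarrow> real ^ 'k"
      assume *: "\<forall>p \<in> borel_measurable MX. (AE w in M. (p (X w) - p0 (X w)) \<bullet> Z w = 0) \<longrightarrow>
        (AE w in M. (p (X w) - p0 (X w)) \<bullet> b = 0)" and [measurable]: "h \<in> borel_measurable MX"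
      show "(AE w in M. h (X w) \<bullet> Z w = 0) \<longrightarrow> (AE w in M. h (X w) \<bullet> b = 0)"
        using *[rule_format, of "\<lambda>x. p0 x + h x"] by simp
    next
      fix p :: "'x \<Rightarrow> real ^ 'k"
      assume *: "\<forall>h \<in> borel_measurable MX.
        (AE w in M. h (X w) \<bullet> Z w = 0) \<longrightarrow> (AE w in M. h (X w) \<bullet> b = 0)"
        and [measurable]: "p \<in> borel_measurable MX"
      show "(AE w in M. (p (X w) - p0 (X w)) \<bullet> Z w = 0) \<longrightarrow>
        (AE w in M. (p (X w) - p0 (X w)) \<bullet> b = 0)"
        using *[rule_format, of "\<lambda>x. p x - p0 x"] by simp
    qed
    finally show ?thesis .
  qed
  have "(AE w in M. b \<in> column_space (A w)) \<longleftrightarrow> ASF_identified M MX X V q p0"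
    unfolding identified_iff
  proof (intro iffI ballI impI)
    fix h :: "'x \<Rightarrow> real ^ 'k"
    assume range: "AE w in M. b \<in> column_space (A w)" and [measurable]: "h \<in> borel_measurable MX"
      and "AE w in M. h (X w) \<bullet> Z w = 0"
    then have "AE w in M. A w *v h (X w) = 0"
      by (subst (asm) kernel) measurable
    with range show "AE w in M. h (X w) \<bullet> b = 0"
      by eventually_elim (meson orth)
  next
    assume identified: "\<forall>h \<in> borel_measurable MX.
      (AE w in M. h (X w) \<bullet> Z w = 0) \<longrightarrow> (AE w in M. h (X w) \<bullet> b = 0)"
    \<comment> \<open>Gram-Schmidt needs the columns as a list; their order is immaterial, since
      only the span matters.\<close>
    obtain js :: "'k list" where js: "set js = UNIV"
      using finite_list[OF finite] by blast
    define cols where "cols = map (\<lambda>j w. column j (A w)) js"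
    have span_cols: "span (set (map (\<lambda>f. f w) cols)) = column_space (A w)" for w
      by (simp add: cols_def image_image js column_space_eq_span columns_def full_SetCompr_eq)
    define d where "d w = orth_residual (map (\<lambda>f. f w) cols) b" for w
    have "f \<in> borel_measurable F" if "f \<in> set cols" for f
      using that
      by (auto simp: cols_def A_def borel_measurable_column_cond_second_moment)
    then have d_F: "d \<in> borel_measurable F"
      unfolding d_def by (intro borel_measurable_orth_residual) auto
    \<comment> \<open>\<open>identified\<close> speaks of functions of \<open>X\<close> alone, so
      \<open>d\<close> has to be factored through \<open>X\<close> before it can serve as a
      counterexample direction.\<close>
    then obtain h where h: "h \<in> borel_measurable MX"
      and d_h: "\<And>w. w \<in> space M \<Longrightarrow> d w = h (X w)"
      unfolding F_def by (rule rv_algebra_factorization[OF X]) blast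
    have "A w *v d w = 0" for w
      unfolding orth[symmetric] by (auto simp: d_def span_cols[symmetric] intro: orth_residual_orthogonal)
    then have "AE w in M. d w \<bullet> Z w = 0"
      using kernel[OF d_F] by simp
    then have "AE w in M. h (X w) \<bullet> Z w = 0"
      using AE_space by eventually_elim (simp add: d_h)
    with identified h have "AE w in M. h (X w) \<bullet> b = 0"
      by blast
    then show "AE w in M. b \<in> column_space (A w)"
      using AE_space
    proof eventually_elim
      case (elim w)
      \<comment> \<open>The inner product of \<open>d w\<close> with \<open>b\<close> is the squared
        norm of \<open>d w\<close>. Once it vanishes, \<open>b\<close> equals its own projection
        onto the column space.\<close>
      then have "d w = 0"
        using inner_orth_residual[of "map (\<lambda>f. f w) cols" b] by (simp add: d_h[symmetric] d_def)
      then show ?case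
        using orth_residual_in_span[of b "map (\<lambda>f. f w) cols"] span_cols by (simp add: d_def)
    qed
  qed
  then show ?thesis
    by (simp add: A_def b_def F_def Z_def[abs_def])
qed

end
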